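(* Assume: (i) $(Y_1,D_1),\dots,(Y_n,D_n)$ are i.i.d. copies of $(Y,D)$, and $Y_1(t),\dots,Y_n(t)$ are observed only at the $T:=T_{pre}+T_{post}+1$ time points $t\in\{-T_{pre},\dots,-1,0,\dots,T_{post}\}$, where $n\to\infty$ and $T\equiv T_n\to\infty$ as $n\to\infty$ such that $T_{pre,n}/T_{post,n}\to c$ for a constant $0<c<\infty$; (ii) $\beta\in C^2([-T_{pre},-1]\cup[0,T_{post}])$; (iii) there exists $\beta^\star\in C^2([-1,-\frac1{T_{pre}}]\cup[0,1])$ such that $\beta(t)=\beta^\star(t^\star(t))$, where $t^\star(t)=t/T_{pre}$ for $t\in[-T_{pre},-1]$ and $t^\star(t)=t/T_{post}$ for $t\in[0,T_{post}]$. Then $$\sup_{t\in[-T_{pre},-1]\cup[0,T_{post}]}\left|\widehat{\widehat\beta}_n(t)-\beta(t)\right|\le c_1\max_{t\in\{-T_{pre},\dots,T_{post}\}}\left|\widehat\beta_n(t)-\beta(t)\right|+\frac{c_2K_{\beta^\star}}{T},$$ where $0<c_1,c_2,K_{\beta^\star}<\infty$ are finite constants with $K_{\beta^\star}=\sup_{t^\star\in(-1,-\frac1{T_{pre}})\cup(0,1)}|\beta^{\star\prime}(t^\star)|$.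
   Context: $T_{pre},T_{post}$ are positive integers (growing with $n$; the index $n$ is suppressed); $t=-1$ is the reference time. For units $i=1,\dots,n$, $D_i\in\{0,1\}$ and $Y_i$ is a real-valued process satisfying $$Y_i(t)=\beta(t)D_i+\lambda_i+\phi(t)+\varepsilon_i(t),\quad t\in[-T_{pre},T_{post}],\qquad\beta(-1)=0,\quad\mathbb E[\varepsilon_i(t)\mid D_i]=0,$$ with $\lambda_i\in\mathbb R$ an unobserved individual effect (possibly correlated with $D_i$), $\phi$ a temporal effect common to all units and $\varepsilon_i$ an error process. $C^2$ of a union of disjoint intervals means twice continuously differentiable on each interval. At the observation times, $$\widehat\beta_n(t)=\left(\frac1n\sum_i\dot D_i^2\right)^{-1}\frac1n\sum_i\dot D_i(\dot Y_i(t)-\dot Y_i(-1)),\quad\dot D_i=D_i-\frac1n\sum_jD_j,\ \dot Y_i(t)=Y_i(t)-\frac1n\sum_jY_j(t).$$ The interpolation estimator $\widehat{\widehat\beta}_n$ on $[-T_{pre},-1]\cup[0,T_{post}]$ is the natural cubic spline interpolant of the points $(t,\widehat\beta_n(t))$, computed separately for $t\in\{-T_{pre},\dots,-1\}$ (on $[-T_{pre},-1]$) and for $t\in\{0,\dots,T_{post}\}$ (on $[0,T_{post}]$): it interpolates the points, is at most cubic between consecutive integers, is $C^2$ on each of the two intervals, and has zero second derivative at $-T_{pre},-1,0,T_{post}$. "Constants" refers to the asymptotic regime, i.e. quantities not varying with $n$ and $T$.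
   Formalization: K_{β*}>0 is claimed only when β* is not constant on both intervals (for β=0 it is 0), and K_{β*}, which by its formula depends on T_pre and β*, is shown finite for each n rather than constant in n; the inequality holds in all cases. *)

theory Defs
  imports "HOL-Probability.Probability"
begin

definition centred :: "nat \<Rightarrow> (nat \<Rightarrow> real) \<Rightarrow> nat \<Rightarrow> real" where
  "centred n x i = x i - (1 / real n) * (\<Sum>j=1..n. x j)"

text \<open>The arguments \<open>D\<close> and \<open>Y\<close> are realised values. If all \<open>D i\<close> coincide, the estimator
  is mathematically undefined; here it is then 0, because \<open>inverse 0 = 0\<close>.\<close>

definition beta_hat :: "nat \<Rightarrow> (nat \<Rightarrow> real) \<Rightarrow> (nat \<Rightarrow> real \<Rightarrow> real) \<Rightarrow> real \<Rightarrow> real" where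
  "beta_hat n D Y t =
     inverse ((1 / real n) * (\<Sum>i=1..n. (centred n D i)\<^sup>2)) *
     ((1 / real n) * (\<Sum>i=1..n. centred n D i *
        (centred n (\<lambda>j. Y j t) i - centred n (\<lambda>j. Y j (-1)) i)))"

text \<open>Derivatives are taken within \<open>S\<close>, hence one-sided at the end points of a closed interval.
  On a one-point interval every function qualifies, with arbitrary derivatives.\<close>

definition C2_derivs_on :: "real set \<Rightarrow> (real \<Rightarrow> real) \<Rightarrow> (real \<Rightarrow> real) \<Rightarrow> (real \<Rightarrow> real) \<Rightarrow> bool" where
  "C2_derivs_on S f f' f'' \<longleftrightarrow>
     (\<forall>x\<in>S. (f has_real_derivative f' x) (at x within S)) \<and>
     (\<forall>x\<in>S. (f' has_real_derivative f'' x) (at x within S)) \<and>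
     continuous_on S f''"

definition C2_on :: "real set \<Rightarrow> (real \<Rightarrow> real) \<Rightarrow> bool" where
  "C2_on S f \<longleftrightarrow> (\<exists>f' f''. C2_derivs_on S f f' f'')"

definition is_natural_cubic_spline :: "int \<Rightarrow> int \<Rightarrow> (real \<Rightarrow> real) \<Rightarrow> (real \<Rightarrow> real) \<Rightarrow> bool" where
  "is_natural_cubic_spline a b y s \<longleftrightarrow>
     (\<forall>k\<in>{a..b}. s (of_int k) = y (of_int k)) \<and>
     (\<forall>k\<in>{a..<b}. \<exists>p :: real poly. degree p \<le> 3 \<and>
        (\<forall>t\<in>{of_int k..of_int (k + 1)}. s t = poly p t)) \<and>
     (\<exists>s' s''. C2_derivs_on {of_int a..of_int b} s s' s'' \<and>
        s'' (of_int a) = 0 \<and> s'' (of_int b) = 0)"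

text \<open>The spline is only determined on \<open>[a, b]\<close>, so uniqueness needs extensionality. For \<open>a = b\<close>
  it is just the single value \<open>y a\<close>.\<close>

definition natural_cubic_spline :: "int \<Rightarrow> int \<Rightarrow> (real \<Rightarrow> real) \<Rightarrow> real \<Rightarrow> real" where
  "natural_cubic_spline a b y =
     (THE s. s \<in> extensional {of_int a..of_int b} \<and> is_natural_cubic_spline a b y s)"

definition spline_estimator :: "nat \<Rightarrow> nat \<Rightarrow> (real \<Rightarrow> real) \<Rightarrow> real \<Rightarrow> real" where
  "spline_estimator Tpre Tpost bh t =
     (if t \<le> -1 then natural_cubic_spline (- int Tpre) (-1) bh t
      else natural_cubic_spline 0 (int Tpost) bh t)"

text \<open>The error \<open>eps i t\<close> is required to be integrable since \<open>real_cond_exp\<close> is total and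
  meaningless otherwise.\<close>

definition did_model ::
  "nat \<Rightarrow> nat \<Rightarrow> nat \<Rightarrow> 'w measure \<Rightarrow> (nat \<Rightarrow> 'w \<Rightarrow> real) \<Rightarrow> (nat \<Rightarrow> real \<Rightarrow> 'w \<Rightarrow> real) \<Rightarrow>
   (nat \<Rightarrow> 'w \<Rightarrow> real) \<Rightarrow> (real \<Rightarrow> real) \<Rightarrow> (nat \<Rightarrow> real \<Rightarrow> 'w \<Rightarrow> real) \<Rightarrow> (real \<Rightarrow> real) \<Rightarrow> bool" where
  "did_model n Tpre Tpost M D Y lam phi eps beta \<longleftrightarrow>
     prob_space M \<and> beta (-1) = 0 \<and>
     (\<forall>i\<in>{1..n}.
        D i \<in> borel_measurable M \<and> (\<forall>\<omega>\<in>space M. D i \<omega> \<in> {0, 1}) \<and>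
        lam i \<in> borel_measurable M \<and>
        (\<forall>t\<in>{- real Tpre..real Tpost}.
           integrable M (eps i t) \<and>
           (AE \<omega> in M. real_cond_exp M (vimage_algebra (space M) (D i) borel) (eps i t) \<omega> = 0) \<and>
           (\<forall>\<omega>\<in>space M. Y i t \<omega> = beta t * D i \<omega> + lam i \<omega> + phi t + eps i t \<omega>)))"

text \<open>\<open>(Y i, D i)\<close> is a random element of path space (product \<open>\<sigma>\<close>-algebra) times \<open>\<real>\<close>; \<open>P\<close> is the
  law of the generic pair \<open>(Y, D)\<close>.\<close>

definition iid_sample ::
  "nat \<Rightarrow> nat \<Rightarrow> nat \<Rightarrow> 'w measure \<Rightarrow> (nat \<Rightarrow> 'w \<Rightarrow> real) \<Rightarrow> (nat \<Rightarrow> real \<Rightarrow> 'w \<Rightarrow> real) \<Rightarrow> bool" where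
  "iid_sample n Tpre Tpost M D Y \<longleftrightarrow>
     (let I = {- real Tpre..real Tpost};
          N = (\<Pi>\<^sub>M t\<in>I. borel) \<Otimes>\<^sub>M borel;
          X = (\<lambda>i \<omega>. (\<lambda>t\<in>I. Y i t \<omega>, D i \<omega>))
      in prob_space.indep_vars M (\<lambda>_. N) X {1..n} \<and>
         (\<exists>P. \<forall>i\<in>{1..n}. distr M N (X i) = P))"

definition time_domain :: "nat \<Rightarrow> nat \<Rightarrow> real set" where
  "time_domain Tpre Tpost = {- real Tpre..-1} \<union> {0..real Tpost}"

definition tstar :: "nat \<Rightarrow> nat \<Rightarrow> real \<Rightarrow> real" where
  "tstar Tpre Tpost t = (if t \<le> -1 then t / real Tpre else t / real Tpost)"

definition K_star :: "nat \<Rightarrow> (real \<Rightarrow> real) \<Rightarrow> ereal" where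
  "K_star Tpre bstar =
     (SUP x \<in> {-1<..<-(1 / real Tpre)} \<union> {0<..<1}. ereal \<bar>deriv bstar x\<bar>)"

end

theory Submission
  imports Defs
begin

text \<open>The moments \<open>M\<^sub>j\<close> (second derivatives at the knots) of a natural cubic spline with unit spacing
  solve \<open>M\<^sub>j\<^sub>-\<^sub>1 + 4 M\<^sub>j + M\<^sub>j\<^sub>+\<^sub>1 = 6 \<Delta>\<^sup>2 y\<close> with zero boundary values. This system is diagonally
  dominant, so it is uniquely solvable and its solution is at most half the right-hand side in the
  maximum norm. Between two knots the spline differs from the linear interpolant by at most an
  eighth of the largest moment, and the second differences of the data are bounded by four times
  the error at the knots plus twice the Lipschitz constant of \<open>\<beta>\<close>, which is of order
  \<open>K\<^bsub>\<beta>\<star>\<^esub> / T\<close> by the rescaling \<open>t\<star>\<close>.\<close>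

section \<open>Diagonally dominant tridiagonal systems\<close>

text \<open>Shooting method: the three-term recurrence is run forward from the left boundary value
  0, with the unknown next entry \<open>x\<close> as a parameter to be tuned so that the right
  boundary value is hit.\<close>

fun shoot :: "(nat \<Rightarrow> real) \<Rightarrow> real \<Rightarrow> nat \<Rightarrow> real" where
  "shoot r x 0 = 0"
| "shoot r x (Suc 0) = x"
| "shoot r x (Suc (Suc j)) = r j - 4 * shoot r x (Suc j) - shoot r x j"

lemma shoot_affine: "shoot r x j = shoot r 0 j + x * shoot (\<lambda>_. 0) 1 j"
  by (induction r x j rule: shoot.induct) (simp_all add: algebra_simps)

text \<open>Dominance of the coefficient 4: each new entry is at least four times the last one minus
  the smaller one before it, in absolute value. Hence the homogeneous solution vanishes at no
  positive index.\<close>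

lemma shoot_homogeneous_increasing:
  "\<bar>shoot (\<lambda>_. 0) 1 j\<bar> < \<bar>shoot (\<lambda>_. 0) 1 (Suc j)\<bar>"
proof (induction j)
  case (Suc j)
  then show ?case by (simp; linarith)
qed simp

lemma tridiagonal_solvable:
  fixes r :: "nat \<Rightarrow> real"
  obtains M where "M 0 = 0" "M N = 0"
    "\<And>j. Suc j < N \<Longrightarrow> M j + 4 * M (Suc j) + M (Suc (Suc j)) = r j"
proof (cases N)
  case 0
  then show ?thesis using that[of "\<lambda>_. 0"] by simp
next
  case (Suc m)
  define h where "h = shoot (\<lambda>_. 0) 1 N"
  have "h \<noteq> 0"
    using shoot_homogeneous_increasing[of m] Suc by (auto simp: h_def)
  \<comment> \<open>The final entry is affine in the parameter with slope \<open>h\<close>; this is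
    its root.\<close>
  define x where "x = - shoot r 0 N / h"
  have "shoot r x N = 0"
    using shoot_affine[of r x N] \<open>h \<noteq> 0\<close> by (simp add: x_def h_def)
  then show ?thesis
    using that[of "shoot r x"] by simp
qed

text \<open>Maximum principle: if \<open>\<bar>M\<bar>\<close> attains its maximum \<open>m\<close>
  at an interior index, the equation centred there gives \<open>4 * m \<le> R + 2 * m\<close>. At a
  boundary index \<open>m\<close> is 0.\<close>

lemma tridiagonal_bound:
  fixes M :: "nat \<Rightarrow> real"
  assumes "M 0 = 0" "M N = 0" "0 \<le> R" "j \<le> N"
    and R: "\<And>j. Suc j < N \<Longrightarrow> \<bar>M j + 4 * M (Suc j) + M (Suc (Suc j))\<bar> \<le> R"
  shows "\<bar>M j\<bar> \<le> R / 2"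
proof -
  define m where "m = Max ((\<lambda>j. \<bar>M j\<bar>) ` {..N})"
  have le: "\<bar>M i\<bar> \<le> m" if "i \<le> N" for i
    using that by (auto simp: m_def intro!: Max_ge)
  have "m \<in> (\<lambda>j. \<bar>M j\<bar>) ` {..N}"
    unfolding m_def by (rule Max_in) auto
  then obtain i where i: "i \<le> N" "m = \<bar>M i\<bar>" by auto
  have "m \<le> R / 2"
  proof (cases "i = 0 \<or> i = N")
    case True
    then show ?thesis using i assms by auto
  next
    case False
    then obtain l where l: "i = Suc l" "Suc l < N"
      using i by (metis le_neq_implies_less not0_implies_Suc)
    have "\<bar>M l\<bar> \<le> m" "\<bar>M (Suc (Suc l))\<bar> \<le> m"
      using l le by auto
    moreover have "m = \<bar>M (Suc l)\<bar>" using i l by simp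
    ultimately show ?thesis using R[OF l(2)] by linarith
  qed
  then show ?thesis using le[OF assms(4)] by linarith
qed

section \<open>Natural cubic splines\<close>

text \<open>\<open>seg\<close> is the cubic on \<open>[0, 1]\<close> with end values \<open>y0\<close>, \<open>y1\<close> and second derivatives
  \<open>m0\<close>, \<open>m1\<close> there.\<close>

definition seg :: "real \<Rightarrow> real \<Rightarrow> real \<Rightarrow> real \<Rightarrow> real \<Rightarrow> real" where
  "seg y0 y1 m0 m1 u =
     (1 - u) * y0 + u * y1 - u * (1 - u) / 6 * ((2 - u) * m0 + (1 + u) * m1)"

definition seg' :: "real \<Rightarrow> real \<Rightarrow> real \<Rightarrow> real \<Rightarrow> real \<Rightarrow> real" where
  "seg' y0 y1 m0 m1 u =
     y1 - y0 + (m0 - m1) / 6 - m0 * (1 - u)\<^sup>2 / 2 + m1 * u\<^sup>2 / 2"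

definition seg'' :: "real \<Rightarrow> real \<Rightarrow> real \<Rightarrow> real" where
  "seg'' m0 m1 u = (1 - u) * m0 + u * m1"

lemma seg_deriv: "(seg y0 y1 m0 m1 has_real_derivative seg' y0 y1 m0 m1 u) (at u within A)"
  unfolding seg_def[abs_def] seg'_def
  by (rule derivative_eq_intros refl | simp)+ (simp add: field_simps power2_eq_square)

lemma seg'_deriv: "(seg' y0 y1 m0 m1 has_real_derivative seg'' m0 m1 u) (at u within A)"
  unfolding seg'_def[abs_def] seg''_def
  by (rule derivative_eq_intros refl | simp)+ (simp add: field_simps power2_eq_square)

text \<open>The cubic correction is a product of \<open>u * (1 - u) / 6\<close>, at most 1/24, and a
  combination of the moments whose nonnegative weights \<open>2 - u\<close> and \<open>1 + u\<close>
  add up to 3.\<close>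

lemma seg_linear_error:
  assumes "u \<in> {0..1}" "\<bar>m0\<bar> \<le> m" "\<bar>m1\<bar> \<le> m"
  shows "\<bar>seg y0 y1 m0 m1 u - ((1 - u) * y0 + u * y1)\<bar> \<le> m / 8"
proof -
  have u: "0 \<le> u" "u \<le> 1" using assms by auto
  have "\<bar>(2 - u) * m0 + (1 + u) * m1\<bar> \<le> \<bar>(2 - u) * m0\<bar> + \<bar>(1 + u) * m1\<bar>"
    by (rule abs_triangle_ineq)
  also have "\<dots> \<le> (2 - u) * m + (1 + u) * m"
    using u assms by (intro add_mono) (auto simp: abs_mult intro!: mult_left_mono)
  finally have *: "\<bar>(2 - u) * m0 + (1 + u) * m1\<bar> \<le> 3 * m" by (simp add: algebra_simps)
  have "0 \<le> (2 * u - 1)\<^sup>2" by simp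
  then have q: "u * (1 - u) / 6 \<le> 1 / 24" by (simp add: power2_eq_square algebra_simps)
  have "\<bar>seg y0 y1 m0 m1 u - ((1 - u) * y0 + u * y1)\<bar> =
      u * (1 - u) / 6 * \<bar>(2 - u) * m0 + (1 + u) * m1\<bar>"
    using u by (simp add: seg_def abs_mult)
  also have "\<dots> \<le> 1 / 24 * (3 * m)"
    by (rule mult_mono[OF q *]) auto
  finally show ?thesis by simp
qed

text \<open>A cubic has four coefficients, and its values and second derivatives at two points one
  unit apart determine them. This turns every piece of a spline into the form
  \<open>seg\<close>.\<close>

lemma poly_eq_seg:
  fixes p :: "real poly"
  assumes "degree p \<le> 3"
  defines "p1 \<equiv> pderiv p" and "p2 \<equiv> pderiv (pderiv p)"
  shows "poly p (x + u) = seg (poly p x) (poly p (x + 1)) (poly p2 x) (poly p2 (x + 1)) u"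
    and "poly p1 (x + u) = seg' (poly p x) (poly p (x + 1)) (poly p2 x) (poly p2 (x + 1)) u"
proof -
  obtain c0 c1 c2 c3 where p: "p = [:c0, c1, c2, c3:]"
  proof -
    have "p = [:coeff p 0, coeff p 1, coeff p 2, coeff p 3:]"
    proof (rule poly_eqI)
      fix n :: nat
      consider "n = 0" | "n = 1" | "n = 2" | "n = 3" | "n > 3" by linarith
      then show "coeff p n = coeff [:coeff p 0, coeff p 1, coeff p 2, coeff p 3:] n"
        using assms(1)
        by cases (auto simp: numeral_eq_Suc coeff_pCons coeff_eq_0 split: nat.splits)
    qed
    then show ?thesis using that by blast
  qed
  show "poly p (x + u) = seg (poly p x) (poly p (x + 1)) (poly p2 x) (poly p2 (x + 1)) u"
    unfolding p2_def p by (simp add: seg_def pderiv_pCons field_simps)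
  show "poly p1 (x + u) = seg' (poly p x) (poly p (x + 1)) (poly p2 x) (poly p2 (x + 1)) u"
    unfolding p2_def p1_def p by (simp add: seg'_def pderiv_pCons field_simps power2_eq_square)
qed

section \<open>Moment equations and uniqueness of the natural spline\<close>

lemma real_derivative_unique_within_Icc:
  fixes f :: "real \<Rightarrow> real"
  assumes "(f has_real_derivative d) (at x within {p..q})"
    and "(f has_real_derivative e) (at x within {p..q})" "p < q" "x \<in> {p..q}"
  shows "d = e"
  using assms vector_derivative_unique_within_closed_interval[of p q x f d e]
  by (simp add: has_real_derivative_iff_has_vector_derivative)

lemma derivative_cong_on:
  fixes f :: "real \<Rightarrow> real"
  assumes "(f has_real_derivative d) (at x within A)" "x \<in> A" "\<And>z. z \<in> A \<Longrightarrow> g z = f z"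
  shows "(g has_real_derivative d) (at x within A)"
  using has_field_derivative_transform_within[OF assms(1) zero_less_one assms(2)] assms(3) by metis

text \<open>The moments are the values of \<open>s''\<close> at the knots. Continuity of
  \<open>s''\<close> lets neighbouring pieces share a moment, and continuity of \<open>s'\<close> at
  the interior knots is what the linear system expresses.\<close>

lemma natural_spline_moments:
  fixes a :: int and N :: nat and y s :: "real \<Rightarrow> real"
  defines "Y \<equiv> \<lambda>j. y (of_int a + real j)"
  assumes s: "is_natural_cubic_spline a (a + int N) y s" and "0 < N"
  obtains M where "M 0 = 0" "M N = 0"
    "\<And>j. Suc j < N \<Longrightarrow> M j + 4 * M (Suc j) + M (Suc (Suc j)) =
        6 * (Y (Suc (Suc j)) - 2 * Y (Suc j) + Y j)"
    "\<And>j u. j < N \<Longrightarrow> u \<in> {0..1} \<Longrightarrow>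
        s (of_int a + real j + u) = seg (Y j) (Y (Suc j)) (M j) (M (Suc j)) u"
proof -
  let ?b = "a + int N"
  obtain s' s'' where C2: "C2_derivs_on {of_int a..of_int ?b} s s' s''"
    and ends: "s'' (of_int a) = 0" "s'' (of_int ?b) = 0"
    using s unfolding is_natural_cubic_spline_def by blast
  define M where "M j = s'' (of_int a + real j)" for j
  have Y: "s (of_int a + real j) = Y j" if "j \<le> N" for j
  proof -
    have "a + int j \<in> {a..?b}" using that by simp
    then have "s (of_int (a + int j)) = y (of_int (a + int j))"
      using s unfolding is_natural_cubic_spline_def by blast
    then show ?thesis by (simp add: Y_def)
  qed
  have pieces: "s (of_int a + real j + u) = seg (Y j) (Y (Suc j)) (M j) (M (Suc j)) u"
      "s' (of_int a + real j + u) = seg' (Y j) (Y (Suc j)) (M j) (M (Suc j)) u"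
    if "j < N" "u \<in> {0..1}" for j u
  proof -
    define x where "x = of_int a + real j"
    have "a + int j \<in> {a..<?b}" using that by simp
    then obtain p where p: "degree p \<le> 3"
      "\<forall>t\<in>{of_int (a + int j)..of_int (a + int j + 1)}. s t = poly p t"
      using s unfolding is_natural_cubic_spline_def by blast
    then have sp: "s t = poly p t" if "t \<in> {x..x + 1}" for t
      using that by (auto simp: x_def)
    have sub: "{x..x + 1} \<subseteq> {of_int a..of_int ?b}"
      using \<open>j < N\<close> by (auto simp: x_def)
    \<comment> \<open>Restricted to one closed cell, derivatives are unique even at its end points.
      So \<open>s'\<close> and then \<open>s''\<close> agree with the derivatives of the cubic piece
      at the knots too, from either side.\<close>
    have s': "s' t = poly (pderiv p) t" if t: "t \<in> {x..x + 1}" for t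
    proof (rule real_derivative_unique_within_Icc[of s _ t x "x + 1"])
      show "(s has_real_derivative s' t) (at t within {x..x + 1})"
        using C2 t sub unfolding C2_derivs_on_def by (blast intro: DERIV_subset)
      show "(s has_real_derivative poly (pderiv p) t) (at t within {x..x + 1})"
        by (rule derivative_cong_on[of "poly p"]) (use t sp in \<open>auto intro: DERIV_subset[OF poly_DERIV]\<close>)
    qed (use t in auto)
    have s'': "s'' t = poly (pderiv (pderiv p)) t" if t: "t \<in> {x..x + 1}" for t
    proof (rule real_derivative_unique_within_Icc[of s' _ t x "x + 1"])
      show "(s' has_real_derivative s'' t) (at t within {x..x + 1})"
        using C2 t sub unfolding C2_derivs_on_def by (blast intro: DERIV_subset)
      show "(s' has_real_derivative poly (pderiv (pderiv p)) t) (at t within {x..x + 1})"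
        by (rule derivative_cong_on[of "poly (pderiv p)"])
          (use t s' in \<open>auto intro: DERIV_subset[OF poly_DERIV]\<close>)
    qed (use t in auto)
    have x1: "x + 1 = of_int a + real (Suc j)" by (simp add: x_def)
    have eqs: "poly p x = Y j" "poly p (x + 1) = Y (Suc j)"
      "poly (pderiv (pderiv p)) x = M j" "poly (pderiv (pderiv p)) (x + 1) = M (Suc j)"
      using sp[of x] sp[of "x + 1"] s''[of x] s''[of "x + 1"] Y[of j] Y[of "Suc j"] \<open>j < N\<close>
      unfolding M_def x1[symmetric] x_def[symmetric] by auto
    have xu: "x + u \<in> {x..x + 1}" using that by auto
    show "s (of_int a + real j + u) = seg (Y j) (Y (Suc j)) (M j) (M (Suc j)) u"
      "s' (of_int a + real j + u) = seg' (Y j) (Y (Suc j)) (M j) (M (Suc j)) u"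
      using poly_eq_seg[OF p(1), of x u] sp[OF xu] s'[OF xu]
      unfolding x_def[symmetric] eqs by simp_all
  qed
  show ?thesis
  proof (rule that[of M])
    show "M 0 = 0" "M N = 0" using ends by (simp_all add: M_def)
    \<comment> \<open>Knot \<open>Suc j\<close> is the point \<open>u = 1\<close> of cell
      \<open>j\<close> and the point \<open>u = 0\<close> of the next cell; the two expressions for
      \<open>s'\<close> there are equated.\<close>
    show "M j + 4 * M (Suc j) + M (Suc (Suc j)) = 6 * (Y (Suc (Suc j)) - 2 * Y (Suc j) + Y j)"
      if "Suc j < N" for j
      using pieces(2)[of j 1] pieces(2)[of "Suc j" 0] that
      by (simp add: seg'_def field_simps)
  qed (rule pieces(1))
qed

lemma unit_interval_cell:
  fixes t :: real and a :: int
  assumes "0 < N" "t \<in> {of_int a..of_int a + real N}"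
  obtains j u where "j < N" "u \<in> {0..1}" "t = of_int a + real j + u"
\<comment> \<open>At the right end the floor would give the nonexistent cell \<open>N\<close>; this
  point is assigned to the last cell with \<open>u = 1\<close>.\<close>
proof (cases "t = of_int a + real N")
  case True
  then show ?thesis using assms that[of "N - 1" 1] by (simp add: of_nat_diff)
next
  case False
  define j where "j = nat \<lfloor>t - of_int a\<rfloor>"
  have "0 \<le> \<lfloor>t - of_int a\<rfloor>" using assms by (subst zero_le_floor) auto
  then have "real j = of_int \<lfloor>t - of_int a\<rfloor>" unfolding j_def by (rule of_nat_nat)
  then have "real j \<le> t - of_int a" "t - of_int a < real j + 1" by linarith+
  moreover from this have "real j < real N" using assms False by auto
  ultimately show ?thesis
    using that[of j "t - of_int a - real j"] by auto
qed

text \<open>Two splines through the same data have moment sequences whose difference solves the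
  homogeneous system, so the maximum principle with right-hand side 0 makes it vanish.\<close>

lemma natural_spline_unique:
  assumes "is_natural_cubic_spline a b y s1" "is_natural_cubic_spline a b y s2"
    and "t \<in> {of_int a..of_int b}"
  shows "s1 t = s2 t"
proof (cases "a = b")
  case True
  then have "t = of_int a" "a \<in> {a..b}" using assms(3) by auto
  then show ?thesis using assms(1,2) unfolding is_natural_cubic_spline_def by metis
next
  case False
  define N where "N = nat (b - a)"
  have "a \<le> b" using assms(3) by auto
  then have b: "b = a + int N" and "0 < N" using False by (auto simp: N_def)
  define Y where "Y j = y (of_int a + real j)" for j
  obtain M1 where M1: "M1 0 = 0" "M1 N = 0"
    "\<And>j. Suc j < N \<Longrightarrow> M1 j + 4 * M1 (Suc j) + M1 (Suc (Suc j)) =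
        6 * (Y (Suc (Suc j)) - 2 * Y (Suc j) + Y j)"
    "\<And>j u. j < N \<Longrightarrow> u \<in> {0..1} \<Longrightarrow>
        s1 (of_int a + real j + u) = seg (Y j) (Y (Suc j)) (M1 j) (M1 (Suc j)) u"
    using natural_spline_moments[OF assms(1)[unfolded b] \<open>0 < N\<close>] unfolding Y_def by metis
  obtain M2 where M2: "M2 0 = 0" "M2 N = 0"
    "\<And>j. Suc j < N \<Longrightarrow> M2 j + 4 * M2 (Suc j) + M2 (Suc (Suc j)) =
        6 * (Y (Suc (Suc j)) - 2 * Y (Suc j) + Y j)"
    "\<And>j u. j < N \<Longrightarrow> u \<in> {0..1} \<Longrightarrow>
        s2 (of_int a + real j + u) = seg (Y j) (Y (Suc j)) (M2 j) (M2 (Suc j)) u"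
    using natural_spline_moments[OF assms(2)[unfolded b] \<open>0 < N\<close>] unfolding Y_def by metis
  have M: "M1 j = M2 j" if "j \<le> N" for j
  proof -
    have "\<bar>M1 i + 4 * M1 (Suc i) + M1 (Suc (Suc i)) -
        (M2 i + 4 * M2 (Suc i) + M2 (Suc (Suc i)))\<bar> \<le> 0" if "Suc i < N" for i
      using M1(3)[OF that] M2(3)[OF that] by simp
    then have "\<bar>M1 j - M2 j\<bar> \<le> 0 / 2"
      by (intro tridiagonal_bound[of "\<lambda>j. M1 j - M2 j" N])
        (use M1 M2 \<open>j \<le> N\<close> in \<open>auto simp: algebra_simps\<close>)
    then show ?thesis by simp
  qed
  obtain j u where "j < N" "u \<in> {0..1}" "t = of_int a + real j + u"
    using unit_interval_cell[OF \<open>0 < N\<close>, of t a] assms(3) b by auto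
  then show ?thesis using M1(4) M2(4) M[of j] M[of "Suc j"] by simp
qed

section \<open>Existence of the natural spline by truncated powers\<close>

lemma pos_part_power_deriv:
  "((\<lambda>t. (max 0 (t - c)) ^ Suc (Suc k)) has_real_derivative
     real (Suc (Suc k)) * (max 0 (t - c)) ^ Suc k) (at t)"
proof -
  consider "t < c" | "t > c" | "t = c" by linarith
  then show ?thesis
  proof cases
    case 1
    have "((\<lambda>_. 0) has_real_derivative 0) (at t)" by simp
    then have "((\<lambda>t. (max 0 (t - c)) ^ Suc (Suc k)) has_real_derivative 0) (at t)"
      by (rule has_field_derivative_transform_within_open[of _ _ _ "{..<c}"]) (use 1 in \<open>auto simp: max_def\<close>)
    then show ?thesis using 1 by (simp add: max_def)
  next
    case 2
    have "((\<lambda>t. (t - c) ^ Suc (Suc k)) has_real_derivative real (Suc (Suc k)) * (t - c) ^ Suc k) (at t)"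
      by (rule derivative_eq_intros refl | simp)+
    then have "((\<lambda>t. (max 0 (t - c)) ^ Suc (Suc k)) has_real_derivative
        real (Suc (Suc k)) * (t - c) ^ Suc k) (at t)"
      by (rule has_field_derivative_transform_within_open[of _ _ _ "{c<..}"]) (use 2 in \<open>auto simp: max_def\<close>)
    then show ?thesis using 2 by (simp add: max_def)
  next
    case 3
    \<comment> \<open>At the kink the difference quotient is dominated by
      \<open>\<bar>z - c\<bar> ^ Suc k\<close>, a positive power, so exponent at least 2 makes the
      derivative 0 there.\<close>
    have "((\<lambda>z. (max 0 (z - c)) ^ Suc (Suc k) / (z - c)) \<longlongrightarrow> 0) (at c)"
    proof (rule Lim_null_comparison)
      have "\<bar>max 0 (z - c) ^ Suc (Suc k) / (z - c)\<bar> \<le> \<bar>z - c\<bar> ^ Suc k" for z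
        by (cases "z \<le> c") (auto simp: max_def)
      then show "\<forall>\<^sub>F z in at c. norm (max 0 (z - c) ^ Suc (Suc k) / (z - c)) \<le> \<bar>z - c\<bar> ^ Suc k"
        by simp
      show "((\<lambda>z. \<bar>z - c\<bar> ^ Suc k) \<longlongrightarrow> 0) (at c)"
        by (auto intro!: tendsto_eq_intros)
    qed
    then show ?thesis using 3 by (simp add: has_field_derivative_iff)
  qed
qed

text \<open>Adjacent cubic pieces differ by a multiple of a truncated cube, which is globally \<open>C\<^sup>2\<close>; hence
  the spline is its first piece plus a sum of truncated cubes, and no gluing at the knots is needed.\<close>

lemma natural_spline_exists:
  assumes "a \<le> b"
  shows "\<exists>s. is_natural_cubic_spline a b y s"
proof (cases "a = b")
  case True
  have "C2_derivs_on {of_int a..of_int b} (\<lambda>_. y (of_int a)) (\<lambda>_. 0) (\<lambda>_. 0)"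
    by (simp add: C2_derivs_on_def)
  then show ?thesis
    unfolding is_natural_cubic_spline_def using True
    by (intro exI[of _ "\<lambda>_. y (of_int a)"]) auto
next
  case False
  define N where "N = nat (b - a)"
  have b: "b = a + int N" and "0 < N" using assms False by (auto simp: N_def)
  define Y where "Y j = y (of_int a + real j)" for j
  obtain M where M: "M 0 = 0" "M N = 0"
    "\<And>j. Suc j < N \<Longrightarrow> M j + 4 * M (Suc j) + M (Suc (Suc j)) =
        6 * (Y (Suc (Suc j)) - 2 * Y (Suc j) + Y j)"
    using tridiagonal_solvable[of N "\<lambda>j. 6 * (Y (Suc (Suc j)) - 2 * Y (Suc j) + Y j)"] by metis
  \<comment> \<open>\<open>c j\<close> is the jump at knot \<open>Suc j\<close> of the slope of the
    piecewise linear \<open>s''\<close>, hence of the third derivative; the truncated cube therefore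
    carries the factor \<open>c j / 6\<close>. There are \<open>N - 1\<close> interior
    knots.\<close>
  define c where "c j = M (Suc (Suc j)) - 2 * M (Suc j) + M j" for j
  define \<tau> where "\<tau> j t = max 0 (t - (of_int a + real (Suc j)))" for j t
  define P where "P j t = seg (Y j) (Y (Suc j)) (M j) (M (Suc j)) (t - (of_int a + real j))" for j t
  define P'' where "P'' j t = seg'' (M j) (M (Suc j)) (t - (of_int a + real j))" for j t
  define s where "s t = P 0 t + (\<Sum>j<N - 1. c j / 6 * \<tau> j t ^ 3)" for t
  define s' where "s' t = seg' (Y 0) (Y (Suc 0)) (M 0) (M (Suc 0)) (t - of_int a) +
    (\<Sum>j<N - 1. c j / 2 * \<tau> j t ^ 2)" for t
  define s'' where "s'' t = P'' 0 t + (\<Sum>j<N - 1. c j * \<tau> j t)" for t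
  have shift: "((\<lambda>t. t - of_int a) has_real_derivative 1) (at t)" for t
    by (rule derivative_eq_intros refl | simp)+
  have \<tau>_deriv: "((\<lambda>t. \<tau> j t ^ 3) has_real_derivative 3 * \<tau> j t ^ 2) (at t)"
    "((\<lambda>t. \<tau> j t ^ 2) has_real_derivative 2 * \<tau> j t) (at t)" for j t
    unfolding \<tau>_def
    using pos_part_power_deriv[of "of_int a + real (Suc j)" 1 t]
      pos_part_power_deriv[of "of_int a + real (Suc j)" 0 t]
    by (simp_all add: eval_nat_numeral)
  have "(s has_real_derivative s' t) (at t)" for t
    unfolding s_def s'_def P_def of_nat_0 add_0_right
    using DERIV_chain2[OF seg_deriv shift] DERIV_cmult[OF \<tau>_deriv(1), of "c j / 6" for j]
    by (intro DERIV_add DERIV_sum) (simp_all add: mult.assoc)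
  moreover have "(s' has_real_derivative s'' t) (at t)" for t
    unfolding s'_def s''_def P''_def of_nat_0 add_0_right
    using DERIV_chain2[OF seg'_deriv shift] DERIV_cmult[OF \<tau>_deriv(2), of "c j / 2" for j]
    by (intro DERIV_add DERIV_sum) (simp_all add: mult.assoc)
  moreover have "continuous_on A s''" for A
    unfolding s''_def P''_def \<tau>_def seg''_def by (intro continuous_intros)
  ultimately have C2: "C2_derivs_on A s s' s''" for A
    by (simp add: C2_derivs_on_def has_field_derivative_at_within)
  have jump: "P (Suc j) t - P j t = c j / 6 * (t - (of_int a + real (Suc j))) ^ 3"
    if "Suc j < N" for j t
  proof -
    define v where "v = t - (of_int a + real (Suc j))"
    have v: "t - (of_int a + real j) = v + 1" by (simp add: v_def)
    \<comment> \<open>Adjacent pieces share value and second derivative at their common knot by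
      construction; the moment equation makes the first derivatives agree as well, which leaves only
      the cubic term in \<open>v\<close>.\<close>
    have Y2: "Y (Suc (Suc j)) = (M j + 4 * M (Suc j) + M (Suc (Suc j))) / 6 + 2 * Y (Suc j) - Y j"
      using M(3)[OF that] by (simp add: field_simps)
    show ?thesis
      unfolding P_def v v_def[symmetric] c_def seg_def Y2
      by (simp add: field_simps power3_eq_cube)
  qed
  have jump'': "P'' (Suc j) t - P'' j t = c j * (t - (of_int a + real (Suc j)))" for j t
    by (simp add: P''_def seg''_def c_def algebra_simps)
  have piece: "s t = P k t" "s'' t = P'' k t"
    if "k < N" "t \<in> {of_int a + real k..of_int a + real k + 1}" for k t
  proof -
    \<comment> \<open>On cell \<open>k\<close> exactly the truncated powers with
      \<open>j < k\<close> are switched on, and there they equal the differences of adjacent pieces,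
      so the sum telescopes from piece 0 to piece \<open>k\<close>.\<close>
    have neg: "\<tau> j t = 0" if "k \<le> j" for j
      using that \<open>t \<in> _\<close> by (auto simp: \<tau>_def)
    have pos: "\<tau> j t = t - (of_int a + real (Suc j))" if "j < k" for j
    proof -
      have "real (Suc j) \<le> real k" using that by linarith
      then show ?thesis using \<open>t \<in> _\<close> by (auto simp: \<tau>_def)
    qed
    have "(\<Sum>j<N - 1. c j / 6 * \<tau> j t ^ 3) = (\<Sum>j<k. c j / 6 * \<tau> j t ^ 3)"
      using neg by (intro sum.mono_neutral_right) (use \<open>k < N\<close> in auto)
    also have "\<dots> = (\<Sum>j<k. P (Suc j) t - P j t)"
      by (rule sum.cong) (use \<open>k < N\<close> jump pos in auto)
    also have "\<dots> = P k t - P 0 t" by (rule sum_lessThan_telescope)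
    finally show "s t = P k t" unfolding s_def by linarith
    have "(\<Sum>j<N - 1. c j * \<tau> j t) = (\<Sum>j<k. c j * \<tau> j t)"
      using neg by (intro sum.mono_neutral_right) (use \<open>k < N\<close> in auto)
    also have "\<dots> = (\<Sum>j<k. P'' (Suc j) t - P'' j t)"
      by (rule sum.cong) (use jump'' pos in auto)
    also have "\<dots> = P'' k t - P'' 0 t" by (rule sum_lessThan_telescope)
    finally show "s'' t = P'' k t" unfolding s''_def by linarith
  qed
  have "\<forall>k\<in>{a..b}. s (of_int k) = y (of_int k)"
  proof
    fix k assume k: "k \<in> {a..b}"
    define j where "j = nat (k - a)"
    have kj: "k = a + int j" "j \<le> N" using k b by (auto simp: j_def)
    show "s (of_int k) = y (of_int k)"
    proof (cases "j < N")
      case True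
      then show ?thesis using piece(1)[of j "of_int k"] kj by (simp add: P_def seg_def Y_def)
    next
      case False
      \<comment> \<open>The last knot starts no cell and is reached as the right end of cell
        \<open>N - 1\<close>.\<close>
      then have "j = Suc (N - 1)" using kj \<open>0 < N\<close> by simp
      then show ?thesis using piece(1)[of "N - 1" "of_int k"] kj \<open>0 < N\<close>
        by (simp add: P_def seg_def Y_def add_ac)
    qed
  qed
  moreover have "\<forall>k\<in>{a..<b}. \<exists>p :: real poly. degree p \<le> 3 \<and>
        (\<forall>t\<in>{of_int k..of_int (k + 1)}. s t = poly p t)"
  proof
    fix k assume k: "k \<in> {a..<b}"
    define j where "j = nat (k - a)"
    have kj: "k = a + int j" "j < N" using k b by (auto simp: j_def)
    define u :: "real poly" where "u = [:- (of_int a + real j), 1:]"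
    define p where "p = smult (Y j) (1 - u) + smult (Y (Suc j)) u -
      u * (1 - u) * (smult (M j / 6) (2 - u) + smult (M (Suc j) / 6) (1 + u))"
    have u: "degree u \<le> 1" "degree (1 - u) \<le> 1" "degree (2 - u) \<le> 1" "degree (1 + u) \<le> 1"
      by (simp_all add: u_def degree_diff_le degree_add_le)
    have "degree (u * (1 - u) * (smult (M j / 6) (2 - u) + smult (M (Suc j) / 6) (1 + u))) \<le> 1 + 1 + 1"
      by (intro order_trans[OF degree_mult_le] add_mono degree_add_le
        order_trans[OF degree_smult_le] u)
    then have "degree p \<le> 3"
      unfolding p_def
      by (intro degree_diff_le degree_add_le order_trans[OF degree_smult_le])
        (use u in auto)
    moreover have "poly p t = P j t" for t
      by (simp add: p_def u_def P_def seg_def field_simps)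
    ultimately show "\<exists>p :: real poly. degree p \<le> 3 \<and>
        (\<forall>t\<in>{of_int k..of_int (k + 1)}. s t = poly p t)"
      using piece(1)[of j] kj by (intro exI[of _ p]) auto
  qed
  moreover have "s'' (of_int a) = 0"
    using piece(2)[of 0 "of_int a"] \<open>0 < N\<close> M by (simp add: P''_def seg''_def)
  moreover have "s'' (of_int b) = 0"
    using piece(2)[of "N - 1" "of_int b"] \<open>0 < N\<close> M b
    by (simp add: P''_def seg''_def of_nat_diff)
  ultimately show ?thesis
    unfolding is_natural_cubic_spline_def using C2 by blast
qed

section \<open>The spline operator and its approximation error\<close>

lemma natural_spline_restrict:
  assumes "is_natural_cubic_spline a b y s"
  shows "is_natural_cubic_spline a b y (restrict s {of_int a..of_int b})"
proof -
  let ?r = "restrict s {of_int a..of_int b}"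
  \<comment> \<open>Derivatives are taken within the interval, so values outside it do not affect
    them, even at the end points.\<close>
  have "C2_derivs_on {of_int a..of_int b} ?r s' s''"
    if "C2_derivs_on {of_int a..of_int b} s s' s''" for s' s''
    using that unfolding C2_derivs_on_def by (auto intro: derivative_cong_on[of s])
  moreover have "?r t = s t" if "k \<in> {a..<b}" "t \<in> {of_int k..of_int (k + 1)}" for k t
  proof -
    have "of_int a \<le> t" using that by (auto intro: order_trans[of _ "of_int k"])
    moreover have "t \<le> of_int b"
      using that by (auto intro: order_trans[of _ "of_int (k + 1)"] simp flip: of_int_add)
    ultimately show ?thesis by simp
  qed
  ultimately show ?thesis
    using assms unfolding is_natural_cubic_spline_def by (auto; metis)
qed

text \<open>Justifies the definite description: restricting any spline gives an extensional one, and
  agreement on the interval together with extensionality gives equality of functions.\<close>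

lemma natural_cubic_spline_correct:
  assumes "a \<le> b"
  shows "is_natural_cubic_spline a b y (natural_cubic_spline a b y)"
proof -
  let ?Q = "\<lambda>s. s \<in> extensional {of_int a..of_int b} \<and> is_natural_cubic_spline a b y s"
  obtain s where s: "is_natural_cubic_spline a b y s"
    using natural_spline_exists[OF assms] by blast
  have "\<exists>!s. ?Q s"
  proof (rule ex1I)
    show "?Q (restrict s {of_int a..of_int b})"
      using natural_spline_restrict[OF s] by auto
    show "r = restrict s {of_int a..of_int b}" if "?Q r" for r
      using that natural_spline_unique[OF _ s]
      by (intro extensionalityI[of _ "{of_int a..of_int b}"]) auto
  qed
  then show ?thesis
    unfolding natural_cubic_spline_def using theI'[of ?Q] by blast
qed

text \<open>The linear interpolant of the data stays within \<open>E + L\<close> of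
  \<open>g\<close>. The moments are at most \<open>12 * E + 6 * L\<close>, and an eighth of this
  bounds the distance of the spline from that interpolant. The sum is 5/2 \<open>E\<close> plus 7/4
  \<open>L\<close>, rounded up to \<open>2 * L\<close>.\<close>

lemma natural_cubic_spline_error:
  fixes g y :: "real \<Rightarrow> real"
  assumes "0 \<le> L" and t: "t \<in> {of_int a..of_int b}"
    and E: "\<And>k. k \<in> {a..b} \<Longrightarrow> \<bar>y (of_int k) - g (of_int k)\<bar> \<le> E"
    and L: "\<And>x z. x \<in> {of_int a..of_int b} \<Longrightarrow> z \<in> {of_int a..of_int b} \<Longrightarrow>
      \<bar>g x - g z\<bar> \<le> L * \<bar>x - z\<bar>"
  shows "\<bar>natural_cubic_spline a b y t - g t\<bar> \<le> 5 / 2 * E + 2 * L"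
proof -
  have "a \<le> b" using t by auto
  define s where "s = natural_cubic_spline a b y"
  have s: "is_natural_cubic_spline a b y s"
    using natural_cubic_spline_correct[OF \<open>a \<le> b\<close>] by (simp add: s_def)
  have "0 \<le> E" using E[of a] \<open>a \<le> b\<close> by auto
  show ?thesis
  proof (cases "a = b")
    case True
    then have "t = of_int a" "a \<in> {a..b}" using t by auto
    then have "\<bar>s t - g t\<bar> \<le> E"
      using s E[of a] unfolding is_natural_cubic_spline_def by metis
    then show ?thesis using \<open>0 \<le> E\<close> \<open>0 \<le> L\<close> by (simp add: s_def)
  next
    case False
    define N where "N = nat (b - a)"
    have b: "b = a + int N" and "0 < N" using False \<open>a \<le> b\<close> by (auto simp: N_def)
    define Y where "Y j = y (of_int a + real j)" for j
    define G where "G j = g (of_int a + real j)" for j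
    obtain M where M: "M 0 = 0" "M N = 0"
      "\<And>j. Suc j < N \<Longrightarrow> M j + 4 * M (Suc j) + M (Suc (Suc j)) =
          6 * (Y (Suc (Suc j)) - 2 * Y (Suc j) + Y j)"
      "\<And>j u. j < N \<Longrightarrow> u \<in> {0..1} \<Longrightarrow>
          s (of_int a + real j + u) = seg (Y j) (Y (Suc j)) (M j) (M (Suc j)) u"
      using natural_spline_moments[OF s[unfolded b] \<open>0 < N\<close>] unfolding Y_def by metis
    have YG: "\<bar>Y j - G j\<bar> \<le> E" if "j \<le> N" for j
      using E[of "a + int j"] that b by (simp add: Y_def G_def)
    have GG: "\<bar>G (Suc j) - G j\<bar> \<le> L" if "Suc j \<le> N" for j
    proof -
      have "real (Suc j) \<le> real N" using that by linarith
      then show ?thesis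
        using L[of "of_int a + real (Suc j)" "of_int a + real j"] b by (simp add: G_def)
    qed
    have Mb: "\<bar>M j\<bar> \<le> 6 * (4 * E + 2 * L) / 2" if "j \<le> N" for j
    proof (rule tridiagonal_bound[OF M(1,2) _ that])
      show "\<bar>M j + 4 * M (Suc j) + M (Suc (Suc j))\<bar> \<le> 6 * (4 * E + 2 * L)" if "Suc j < N" for j
      proof -
        \<comment> \<open>Passing from \<open>Y\<close> to \<open>G\<close> costs \<open>E\<close>
          with weights 1, 2, 1; the second difference of \<open>G\<close> is a difference of two
          increments, each at most \<open>L\<close>.\<close>
        have "\<bar>Y (Suc (Suc j)) - 2 * Y (Suc j) + Y j\<bar> \<le> 4 * E + 2 * L"
          using YG[of j] YG[of "Suc j"] YG[of "Suc (Suc j)"] GG[of j] GG[of "Suc j"] that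
          by (simp; linarith)
        then show ?thesis unfolding M(3)[OF that] by (simp add: abs_mult)
      qed
    qed (use \<open>0 \<le> E\<close> \<open>0 \<le> L\<close> in simp)
    obtain j u where ju: "j < N" "u \<in> {0..1}" "t = of_int a + real j + u"
      using unit_interval_cell[OF \<open>0 < N\<close>, of t a] t b by auto
    have u: "0 \<le> u" "u \<le> 1" using ju by auto
    have "real (Suc j) \<le> real N" using ju by linarith
    then have tj: "\<bar>G j - g t\<bar> \<le> L * u" "\<bar>G (Suc j) - g t\<bar> \<le> L * (1 - u)"
      using L[of "of_int a + real j" t] L[of "of_int a + real (Suc j)" t] t ju b u
      by (simp_all add: G_def)
    have "L * u \<le> L" "L * (1 - u) \<le> L"
      using \<open>0 \<le> L\<close> u by (simp_all add: mult_left_le)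
    then have "\<bar>Y j - g t\<bar> \<le> E + L" "\<bar>Y (Suc j) - g t\<bar> \<le> E + L"
      using tj YG[of j] YG[of "Suc j"] ju(1) by linarith+
    then have "\<bar>(1 - u) * (Y j - g t)\<bar> \<le> (1 - u) * (E + L)" "\<bar>u * (Y (Suc j) - g t)\<bar> \<le> u * (E + L)"
      using u by (auto simp: abs_mult intro: mult_left_mono)
    moreover have "(1 - u) * Y j + u * Y (Suc j) - g t = (1 - u) * (Y j - g t) + u * (Y (Suc j) - g t)"
      "(1 - u) * (E + L) + u * (E + L) = E + L"
      by (simp_all add: algebra_simps)
    ultimately have "\<bar>(1 - u) * Y j + u * Y (Suc j) - g t\<bar> \<le> E + L" by linarith
    moreover have "\<bar>s t - ((1 - u) * Y j + u * Y (Suc j))\<bar> \<le> 6 * (4 * E + 2 * L) / 2 / 8"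
      unfolding ju(3) M(4)[OF ju(1,2)]
      by (rule seg_linear_error) (use ju Mb in auto)
    moreover have "6 * (4 * E + 2 * L) / 2 / 8 = 3 / 2 * E + 3 / 4 * L" by simp
    ultimately show ?thesis using \<open>0 \<le> L\<close> unfolding s_def[symmetric] by linarith
  qed
qed

section \<open>Lipschitz bounds for \<open>C\<^sup>2\<close> functions\<close>

lemma C2_on_interior_deriv:
  assumes "C2_derivs_on {p..q} f f' f''" "x \<in> {p<..<q}"
  shows "(f has_real_derivative f' x) (at x)"
proof -
  have "p < x" "x < q" "x \<in> {p..q}" using assms(2) by auto
  then show ?thesis
    using assms(1) at_within_Icc_at[of p x q] unfolding C2_derivs_on_def by metis
qed

text \<open>The one-sided derivative \<open>f'\<close> is continuous on a compact interval, hence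
  bounded, and \<open>deriv f\<close> coincides with it at interior points.\<close>

lemma C2_on_deriv_bounded:
  assumes "C2_on {p..q} f"
  obtains B where "\<And>x. x \<in> {p<..<q} \<Longrightarrow> \<bar>deriv f x\<bar> \<le> B"
proof -
  obtain f' f'' where C2: "C2_derivs_on {p..q} f f' f''"
    using assms unfolding C2_on_def by blast
  then have "continuous_on {p..q} f'"
    unfolding C2_derivs_on_def by (blast intro: DERIV_continuous_on)
  then have "bounded (f' ` {p..q})"
    by (intro compact_imp_bounded compact_continuous_image compact_Icc)
  then obtain B where "\<And>x. x \<in> {p..q} \<Longrightarrow> \<bar>f' x\<bar> \<le> B"
    unfolding bounded_iff by (metis imageI real_norm_def)
  then show ?thesis
    using that C2_on_interior_deriv[OF C2] by (metis DERIV_imp_deriv greaterThanLessThan_subseteq_atLeastAtMost_iff order_refl subsetD)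
qed

text \<open>The mean value theorem yields an interior point, so a bound on the open interval gives
  the estimate up to the end points.\<close>

lemma C2_on_lipschitz:
  assumes "C2_on {p..q} f" "\<And>x. x \<in> {p<..<q} \<Longrightarrow> \<bar>deriv f x\<bar> \<le> K"
    and "x \<in> {p..q}" "z \<in> {p..q}"
  shows "\<bar>f x - f z\<bar> \<le> K * \<bar>x - z\<bar>"
proof -
  obtain f' f'' where C2: "C2_derivs_on {p..q} f f' f''"
    using assms(1) unfolding C2_on_def by blast
  then have cont: "continuous_on {p..q} f"
    unfolding C2_derivs_on_def by (blast intro: DERIV_continuous_on)
  have less: "\<bar>f w - f v\<bar> \<le> K * \<bar>w - v\<bar>" if "v < w" "v \<in> {p..q}" "w \<in> {p..q}" for v w
  proof -
    have "\<exists>l \<xi>. v < \<xi> \<and> \<xi> < w \<and> DERIV f \<xi> :> l \<and> f w - f v = (w - v) * l"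
    proof (rule MVT[OF \<open>v < w\<close>])
      show "continuous_on {v..w} f"
        by (rule continuous_on_subset[OF cont]) (use that in auto)
      show "f differentiable (at x)" if "v < x" "x < w" for x
        using C2_on_interior_deriv[OF C2, of x] that \<open>v \<in> _\<close> \<open>w \<in> _\<close>
        by (auto simp: real_differentiable_def)
    qed
    then obtain l \<xi> where l: "v < \<xi>" "\<xi> < w" "DERIV f \<xi> :> l" "f w - f v = (w - v) * l"
      by blast
    then have "\<bar>l\<bar> \<le> K" using assms(2)[of \<xi>] that DERIV_imp_deriv[OF l(3)] by auto
    then show ?thesis
      using l(4) \<open>v < w\<close> by (simp add: abs_mult mult.commute mult_right_mono)
  qed
  show ?thesis
    using less[of x z] less[of z x] assms(3,4)
    by (cases x z rule: linorder_cases) (auto simp: abs_minus_commute)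
qed

lemma K_star_finite:
  assumes "C2_on {-1..-(1 / real m)} f" "C2_on {0..1} f"
  obtains K where "K_star m f = ereal K" "0 \<le> K"
    "\<And>x. x \<in> {-1<..<-(1 / real m)} \<union> {0<..<1} \<Longrightarrow> \<bar>deriv f x\<bar> \<le> K"
proof -
  let ?A = "{-1<..<-(1 / real m)} \<union> {0<..<1}"
  obtain B1 where B1: "\<And>x. x \<in> {-1<..<-(1 / real m)} \<Longrightarrow> \<bar>deriv f x\<bar> \<le> B1"
    using C2_on_deriv_bounded[OF assms(1)] by metis
  obtain B2 where B2: "\<And>x. x \<in> {0<..<1} \<Longrightarrow> \<bar>deriv f x\<bar> \<le> B2"
    using C2_on_deriv_bounded[OF assms(2)] by metis
  have up: "ereal \<bar>deriv f x\<bar> \<le> K_star m f" if "x \<in> ?A" for x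
    unfolding K_star_def by (rule SUP_upper[OF that])
  \<comment> \<open>The index set must be nonempty for the supremum to be at least 0 instead of
    minus infinity. Its left part is empty for \<open>m = 1\<close>, so the witness comes from the
    right part.\<close>
  have "(1 / 2 :: real) \<in> ?A" by auto
  then have "ereal 0 \<le> K_star m f"
    using up[of "1 / 2"] order_trans[of "ereal 0" "ereal \<bar>deriv f (1/2)\<bar>"] by simp
  moreover have "K_star m f \<le> ereal (max B1 B2)"
    unfolding K_star_def by (rule SUP_least) (use B1 B2 in \<open>force simp: le_max_iff_disj\<close>)
  ultimately obtain K where "K_star m f = ereal K" "0 \<le> K"
    by (cases "K_star m f") (auto simp flip: ereal_max)
  then show ?thesis using that up by simp
qed

section \<open>The spline estimator\<close>

text \<open>A convergent sequence is bounded over all indices, which makes the constants of the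
  theorem valid for every \<open>n\<close> and not only eventually.\<close>

lemma LIMSEQ_bounded_above:
  fixes f :: "nat \<Rightarrow> real"
  assumes "f \<longlonglongrightarrow> c"
  obtains B where "0 < B" "\<And>n. f n \<le> B"
proof -
  obtain B where "0 < B" "\<And>n. norm (f n) \<le> B"
    using convergent_imp_Bseq[of f] assms unfolding convergent_def Bseq_def by blast
  then show ?thesis using that[of B] by (metis abs_le_D1 real_norm_def)
qed

theorem theorem2p7:
  fixes Tpre Tpost :: "nat \<Rightarrow> nat" and c :: real
  assumes "\<And>n. 1 \<le> n \<Longrightarrow> 0 < Tpre n \<and> 0 < Tpost n"
    and "filterlim (\<lambda>n. Tpre n + Tpost n + 1) at_top sequentially"
    and "(\<lambda>n. real (Tpre n) / real (Tpost n)) \<longlonglongrightarrow> c" and "0 < c"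
  shows "\<exists>c1 > 0. \<exists>c2 > 0. \<forall>n \<ge> 1. \<forall>(M :: 'w measure) D Y lam phi eps beta bstar.
    did_model n (Tpre n) (Tpost n) M D Y lam phi eps beta \<longrightarrow>
    iid_sample n (Tpre n) (Tpost n) M D Y \<longrightarrow>
    C2_on {- real (Tpre n)..-1} beta \<and> C2_on {0..real (Tpost n)} beta \<longrightarrow>
    C2_on {-1..-(1 / real (Tpre n))} bstar \<and> C2_on {0..1} bstar \<longrightarrow>
    (\<forall>t \<in> time_domain (Tpre n) (Tpost n). beta t = bstar (tstar (Tpre n) (Tpost n) t)) \<longrightarrow>
    K_star (Tpre n) bstar < \<infinity> \<and>
    (0 < K_star (Tpre n) bstar \<or>
      bstar constant_on {-1..-(1 / real (Tpre n))} \<and> bstar constant_on {0..1}) \<and>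
    (\<forall>\<omega> \<in> space M.
      let bh = beta_hat n (\<lambda>i. D i \<omega>) (\<lambda>i t. Y i t \<omega>) in
      (SUP t \<in> time_domain (Tpre n) (Tpost n).
         ereal \<bar>spline_estimator (Tpre n) (Tpost n) bh t - beta t\<bar>)
      \<le> ereal (c1 * (MAX k \<in> {- int (Tpre n)..int (Tpost n)}. \<bar>bh (of_int k) - beta (of_int k)\<bar>))
        + ereal c2 * K_star (Tpre n) bstar / ereal (real (Tpre n + Tpost n + 1)))"
proof -
  note pos = assms(1)
  obtain B1 where B1: "0 < B1" "\<And>n. real (Tpre n) / real (Tpost n) \<le> B1"
    using LIMSEQ_bounded_above[OF assms(3)] by blast
  \<comment> \<open>Positivity of the limit \<open>c\<close> lets the reciprocal ratio converge too,
    so each half of the time range is controlled by the other.\<close>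
  have "(\<lambda>n. inverse (real (Tpre n) / real (Tpost n))) \<longlonglongrightarrow> inverse c"
    using assms(3,4) by (intro tendsto_inverse) auto
  then obtain B2 where B2: "0 < B2" "\<And>n. real (Tpost n) / real (Tpre n) \<le> B2"
    using LIMSEQ_bounded_above[of "\<lambda>n. inverse (real (Tpre n) / real (Tpost n))"] by auto
  \<comment> \<open>Chosen so that \<open>p + q + 1\<close> is at most \<open>C\<close> times either
    of \<open>p\<close> and \<open>q\<close>: the other length costs a factor \<open>B1\<close> or
    \<open>B2\<close>, and the summand 1 is at most the length itself.\<close>
  define C where "C = 2 + B1 + B2"
  have "0 < C" using B1 B2 by (simp add: C_def)
  show ?thesis
  proof (rule exI[of _ "5 / 2"], rule conjI, simp, rule exI[of _ "2 * C"], rule conjI,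
      use \<open>0 < C\<close> in simp, intro allI impI)
    fix n :: nat and M :: "'w measure" and D Y lam phi eps beta bstar
    assume n: "1 \<le> n"
      and beta: "C2_on {- real (Tpre n)..-1} beta \<and> C2_on {0..real (Tpost n)} beta"
      and bstar: "C2_on {-1..-(1 / real (Tpre n))} bstar \<and> C2_on {0..1} bstar"
      and scale: "\<forall>t \<in> time_domain (Tpre n) (Tpost n). beta t = bstar (tstar (Tpre n) (Tpost n) t)"
    define p where "p = Tpre n"
    define q where "q = Tpost n"
    have pq: "0 < p" "0 < q" using pos[OF n] by (auto simp: p_def q_def)
    define T where "T = real (p + q + 1)"
    have "real p \<le> B1 * real q" "real q \<le> B2 * real p"
      using B1(2)[of n] B2(2)[of n] pq by (simp_all add: p_def q_def field_simps)
    moreover have "1 \<le> real p" "1 \<le> real q" using pq by simp_all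
    moreover have "0 \<le> B1 * real p" "0 \<le> B2 * real q" using B1 B2 by simp_all
    ultimately have T: "T \<le> C * real p" "T \<le> C * real q" "0 < T"
      unfolding T_def C_def distrib_right by auto
    obtain K where K: "K_star p bstar = ereal K" "0 \<le> K"
      "\<And>x. x \<in> {-1<..<-(1 / real p)} \<union> {0<..<1} \<Longrightarrow> \<bar>deriv bstar x\<bar> \<le> K"
      using K_star_finite[of p bstar] bstar unfolding p_def by metis
    have lip_pre: "\<bar>bstar x - bstar z\<bar> \<le> K * \<bar>x - z\<bar>"
      if "x \<in> {-1..-(1 / real p)}" "z \<in> {-1..-(1 / real p)}" for x z
      by (rule C2_on_lipschitz[OF _ K(3) that]) (use bstar p_def in auto)
    have lip_post: "\<bar>bstar x - bstar z\<bar> \<le> K * \<bar>x - z\<bar>"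
      if "x \<in> {0..1}" "z \<in> {0..1}" for x z
      by (rule C2_on_lipschitz[OF _ K(3) that]) (use bstar in auto)
    \<comment> \<open>Undoing the time scaling divides the Lipschitz constant \<open>K\<close> by
      \<open>p\<close> or \<open>q\<close>, and both quotients are at most \<open>L\<close>. The
      spline error contains \<open>2 * L\<close>, whence \<open>c2 = 2 * C\<close>.\<close>
    define L where "L = C * K / T"
    have "0 \<le> L" using \<open>0 < C\<close> K(2) T(3) by (simp add: L_def)
    have rescale: "K * \<bar>x / real m - z / real m\<bar> \<le> L * \<bar>x - z\<bar>"
      if "T \<le> C * real m" "0 < m" for m x z
    proof -
      have "K / real m \<le> L"
        using that T(3) mult_left_mono[OF that(1) K(2)]
        by (simp add: L_def field_simps)
      then have "K / real m * \<bar>x - z\<bar> \<le> L * \<bar>x - z\<bar>"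
        by (rule mult_right_mono) simp
      moreover have "\<bar>x / real m - z / real m\<bar> = \<bar>x - z\<bar> / real m"
        by (simp flip: diff_divide_distrib)
      ultimately show ?thesis by simp
    qed
    have beta_pre: "\<bar>beta x - beta z\<bar> \<le> L * \<bar>x - z\<bar>"
      if "x \<in> {- real p..-1}" "z \<in> {- real p..-1}" for x z
    proof -
      have "beta x = bstar (x / real p)" if "x \<in> {- real p..-1}" for x
        using scale that by (auto simp: time_domain_def tstar_def p_def)
      moreover have "x / real p \<in> {-1..-(1 / real p)}" if "x \<in> {- real p..-1}" for x
        using that pq by (auto simp: field_simps)
      ultimately show ?thesis
        using that order_trans[OF lip_pre[of "x / real p" "z / real p"] rescale[OF T(1) pq(1)]]
        by presburger
    qed
    have beta_post: "\<bar>beta x - beta z\<bar> \<le> L * \<bar>x - z\<bar>"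
      if "x \<in> {0..real q}" "z \<in> {0..real q}" for x z
    proof -
      have "beta x = bstar (x / real q)" if "x \<in> {0..real q}" for x
        using scale that by (auto simp: time_domain_def tstar_def q_def)
      moreover have "x / real q \<in> {0..1}" if "x \<in> {0..real q}" for x
        using that pq by (auto simp: field_simps)
      ultimately show ?thesis
        using that order_trans[OF lip_post[of "x / real q" "z / real q"] rescale[OF T(2) pq(2)]]
        by presburger
    qed
    \<comment> \<open>For \<open>K = 0\<close> the Lipschitz estimates collapse to equalities; this
      supplies the alternative to a positive \<open>K_star\<close> in the conclusion.\<close>
    have const: "bstar constant_on {-1..-(1 / real p)} \<and> bstar constant_on {0..1}" if "K = 0"
    proof -
      have "bstar x = bstar z" if "x \<in> {-1..-(1 / real p)}" "z \<in> {-1..-(1 / real p)}" for x z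
        using lip_pre[OF that] \<open>K = 0\<close> by simp
      moreover have "bstar x = bstar z" if "x \<in> {0..1}" "z \<in> {0..1}" for x z
        using lip_post[OF that] \<open>K = 0\<close> by simp
      ultimately show ?thesis unfolding constant_on_def by blast
    qed
    show "K_star (Tpre n) bstar < \<infinity> \<and>
      (0 < K_star (Tpre n) bstar \<or>
        bstar constant_on {-1..-(1 / real (Tpre n))} \<and> bstar constant_on {0..1}) \<and>
      (\<forall>\<omega> \<in> space M.
        let bh = beta_hat n (\<lambda>i. D i \<omega>) (\<lambda>i t. Y i t \<omega>) in
        (SUP t \<in> time_domain (Tpre n) (Tpost n).
           ereal \<bar>spline_estimator (Tpre n) (Tpost n) bh t - beta t\<bar>)
        \<le> ereal (5 / 2 * (MAX k \<in> {- int (Tpre n)..int (Tpost n)}. \<bar>bh (of_int k) - beta (of_int k)\<bar>))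
          + ereal (2 * C) * K_star (Tpre n) bstar / ereal (real (Tpre n + Tpost n + 1)))"
    proof (intro conjI ballI)
      show "K_star (Tpre n) bstar < \<infinity>" using K(1) by (simp add: p_def)
      show "0 < K_star (Tpre n) bstar \<or>
        bstar constant_on {-1..-(1 / real (Tpre n))} \<and> bstar constant_on {0..1}"
        using K(1,2) const by (cases "K = 0") (auto simp: p_def)
      fix \<omega>
      define bh where "bh = beta_hat n (\<lambda>i. D i \<omega>) (\<lambda>i t. Y i t \<omega>)"
      define E where "E = (MAX k \<in> {- int p..int q}. \<bar>bh (of_int k) - beta (of_int k)\<bar>)"
      have E: "\<bar>bh (of_int k) - beta (of_int k)\<bar> \<le> E" if "k \<in> {- int p..int q}" for k
        unfolding E_def by (rule Max_ge) (use that in auto)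
      have "\<bar>spline_estimator p q bh t - beta t\<bar> \<le> 5 / 2 * E + 2 * L" if t: "t \<in> time_domain p q" for t
      \<comment> \<open>The time domain has no point strictly between -1 and 0, so the second case
        means that \<open>t\<close> lies in \<open>{0..real q}\<close>.\<close>
      proof (cases "t \<le> -1")
        case True
        have "\<bar>natural_cubic_spline (- int p) (-1) bh t - beta t\<bar> \<le> 5 / 2 * E + 2 * L"
          by (rule natural_cubic_spline_error[OF \<open>0 \<le> L\<close>])
            (use t True beta_pre E in \<open>auto simp: time_domain_def\<close>)
        then show ?thesis using True by (simp add: spline_estimator_def)
      next
        case False
        have "\<bar>natural_cubic_spline 0 (int q) bh t - beta t\<bar> \<le> 5 / 2 * E + 2 * L"
          by (rule natural_cubic_spline_error[OF \<open>0 \<le> L\<close>])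
            (use t False beta_post E in \<open>auto simp: time_domain_def\<close>)
        then show ?thesis using False by (simp add: spline_estimator_def)
      qed
      then have "(SUP t \<in> time_domain p q. ereal \<bar>spline_estimator p q bh t - beta t\<bar>)
          \<le> ereal (5 / 2 * E + 2 * L)"
        by (intro SUP_least) simp
      also have "\<dots> = ereal (5 / 2 * E) + ereal (2 * C) * K_star p bstar / ereal T"
        using T(3) by (simp add: K(1) L_def)
      finally show "let bh = beta_hat n (\<lambda>i. D i \<omega>) (\<lambda>i t. Y i t \<omega>) in
        (SUP t \<in> time_domain (Tpre n) (Tpost n).
           ereal \<bar>spline_estimator (Tpre n) (Tpost n) bh t - beta t\<bar>)
        \<le> ereal (5 / 2 * (MAX k \<in> {- int (Tpre n)..int (Tpost n)}. \<bar>bh (of_int k) - beta (of_int k)\<bar>))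
          + ereal (2 * C) * K_star (Tpre n) bstar / ereal (real (Tpre n + Tpost n + 1))"
        unfolding Let_def bh_def[symmetric] p_def[symmetric] q_def[symmetric] E_def T_def .
    qed
  qed
qed

end
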